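(* For every integer $m\ge 0$, $$\sum_{k=1}^\infty (\zeta(2k)-1) \frac{F_{2k+m-1}}{k} = F_{m-1}\ln\Big(-\pi\sec\frac{\sqrt{5}\,\pi}{2}\Big)+ \frac{2}{\sqrt{5}}L_{m-1}\ln\alpha$$ and $$\sum_{k=1}^\infty (\zeta(2k)-1) \frac{L_{2k+m-1}}{k} = L_{m-1}\ln\Big(-\pi\sec\frac{\sqrt{5}\,\pi}{2}\Big)+ 2 \sqrt{5}\, F_{m-1}\ln\alpha,$$ where $\alpha=\frac{1+\sqrt5}{2}$.
   Context: $\zeta$ is the Riemann zeta function, $\zeta(s)=\sum_{n\ge1} n^{-s}$ for $\Re(s)>1$; $\sec x = 1/\cos x$; $\ln$ is the real natural logarithm. The Fibonacci numbers $F_n$ and Lucas numbers $L_n$ are defined by $F_0=0$, $F_1=1$, $L_0=2$, $L_1=1$, $F_{n+2}=F_{n+1}+F_n$, $L_{n+2}=L_{n+1}+L_n$, and are extended to negative indices by $F_{-n}=(-1)^{n+1}F_n$ and $L_{-n}=(-1)^nL_n$ (so $F_{-1}=1$, $L_{-1}=-1$). *)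

theory Defs
  imports "HOL-Analysis.Analysis" "HOL-Number_Theory.Fib"
begin

text \<open>
  The Dirichlet series represents the Riemann zeta function exactly on the half-plane
  \<open>Re s > 1\<close>; outside of it the value of this constant has no significance.
\<close>
definition zeta :: "complex \<Rightarrow> complex" where
  "zeta s = (\<Sum>n. 1 / of_nat (Suc n) powr s)"

lemma zeta_sums:
  assumes "Re s > 1"
  shows "(\<lambda>n. 1 / of_nat (Suc n) powr s) sums zeta s"
proof -
  have "summable (\<lambda>n. exp (complex_of_real (ln (of_nat n)) * (- s)))"
    using assms by (intro summable_complex_powr_iff) simp
  hence "summable (\<lambda>n. exp (complex_of_real (ln (of_nat (Suc n))) * (- s)))"
    by (subst summable_Suc_iff)
  also have "(\<lambda>n. exp (complex_of_real (ln (of_nat (Suc n))) * (- s)))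
           = (\<lambda>n. 1 / of_nat (Suc n) powr s)"
  proof
    fix n
    have "of_nat (Suc n) powr s = exp (complex_of_real (ln (of_nat (Suc n))) * s)"
      by (simp add: powr_def mult.commute Ln_of_nat del: of_nat_Suc)
    thus "exp (complex_of_real (ln (of_nat (Suc n))) * (- s)) = 1 / of_nat (Suc n) powr s"
      by (simp add: exp_minus divide_inverse del: of_nat_Suc)
  qed
  finally show ?thesis
    unfolding zeta_def by (rule summable_sums)
qed

fun lucas :: "nat \<Rightarrow> nat" where
  "lucas 0 = 2"
| "lucas (Suc 0) = 1"
| "lucas (Suc (Suc n)) = lucas (Suc n) + lucas n"

text \<open>
  Extension to negative indices by \<open>F (-n) = (-1)^(n+1) * F n\<close> and \<open>L (-n) = (-1)^n * L n\<close>.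
\<close>
definition fib_int :: "int \<Rightarrow> int" where
  "fib_int i = (if i \<ge> 0 then int (fib (nat i))
                else (-1) ^ (nat (-i) + 1) * int (fib (nat (-i))))"

definition lucas_int :: "int \<Rightarrow> int" where
  "lucas_int i = (if i \<ge> 0 then int (lucas (nat i))
                  else (-1) ^ nat (-i) * int (lucas (nat (-i))))"

lemma fib_int_minus_one: "fib_int (-1) = 1"
  and lucas_int_minus_one: "lucas_int (-1) = -1"
  by (simp_all add: fib_int_def lucas_int_def)

definition sec :: "real \<Rightarrow> real" where
  "sec x = 1 / cos x"

definition golden_ratio :: real where
  "golden_ratio = (1 + sqrt 5) / 2"

end

theory Submission
  imports Defs
begin

text \<open>
  The theorem evaluates the generating function
  \[ G(x) = \sum_{k\ge1} (\zeta(2k)-1)\,\frac{x^{2k}}{k}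
     = \ln\frac{\pi x\,(1-x^2)}{\sin(\pi x)} \qquad (|x| < 2) \]
  at the golden ratio \<open>\<alpha>\<close> and at its conjugate \<open>\<beta> = 1 - \<alpha> = -1/\<alpha>\<close>. The formula for \<open>G\<close>
  (lemma \<open>zeta_even_log_series\<close>) comes from inserting the Dirichlet series of \<open>\<zeta>(2k) - 1\<close> and
  summing over \<open>k\<close> first: this turns the series into
  \<open>-(\<Sum>n\<ge>2. ln (1 - x\<^sup>2/n\<^sup>2))\<close>, the logarithm of Euler's sine product with its first factor
  removed. Subtracting \<open>1\<close> from \<open>\<zeta>\<close> is what pushes the radius of convergence
  from \<open>1\<close> to \<open>2\<close>, so that \<open>\<alpha> \<approx> 1.618\<close> is admissible.

  Since \<open>1 - \<alpha>\<^sup>2 = -\<alpha>\<close> and \<open>\<pi>\<alpha> = \<pi>/2 + \<surd>5\<pi>/2\<close>, and likewise for \<open>\<beta>\<close> with \<open>-\<surd>5\<close>,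
  one finds \<open>G(\<alpha>) = A + 2 ln \<alpha>\<close> and \<open>G(\<beta>) = A - 2 ln \<alpha>\<close> with the common term
  \<open>A = ln (-\<pi> sec (\<surd>5\<pi>/2))\<close>. By Binet's formulas, the Fibonacci and Lucas series are the
  linear combinations \<open>(\<alpha>\<^bsup>m-1\<^esup> G(\<alpha>) - \<beta>\<^bsup>m-1\<^esup> G(\<beta>))/\<surd>5\<close> and
  \<open>\<alpha>\<^bsup>m-1\<^esup> G(\<alpha>) + \<beta>\<^bsup>m-1\<^esup> G(\<beta>)\<close>. In each of them \<open>A\<close> is multiplied by the number of the same
  kind at index \<open>m - 1\<close>, whereas \<open>\<plusminus>2 ln \<alpha>\<close> flips the sign between the two powers and
  so is multiplied by the number of the other kind, up to the factor \<open>\<surd>5\<close> or its inverse.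
\<close>

section \<open>The generating function of the even zeta values\<close>

lemma zeta_of_nat_sums:
  assumes "k \<ge> 2"
  shows "(\<lambda>n. complex_of_real (1 / real (Suc n) ^ k)) sums zeta (of_nat k)"
proof -
  have "(\<lambda>n. 1 / of_nat (Suc n) powr (of_nat k :: complex)) sums zeta (of_nat k)"
    using assms by (intro zeta_sums) simp
  moreover have "1 / of_nat (Suc n) powr (of_nat k :: complex) = complex_of_real (1 / real (Suc n) ^ k)"
    for n by (subst powr_nat') (simp_all del: of_nat_Suc)
  ultimately show ?thesis by simp
qed

lemma of_real_Re_zeta_of_nat:
  assumes "k \<ge> 2"
  shows "complex_of_real (Re (zeta (of_nat k))) = zeta (of_nat k)"
proof -
  have "(\<lambda>n. complex_of_real (1 / real (Suc n) ^ k)) sums complex_of_real (Re (zeta (of_nat k)))"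
    using sums_Re[OF zeta_of_nat_sums[OF assms]] by (subst sums_of_real_iff) simp
  thus ?thesis
    using zeta_of_nat_sums[OF assms] sums_unique2 by blast
qed

lemma zeta_of_nat_minus_one_sums:
  assumes "k \<ge> 2"
  shows "(\<lambda>n. 1 / real (n + 2) ^ k) sums (Re (zeta (of_nat k)) - 1)"
proof -
  have "(\<lambda>n. 1 / real (Suc n) ^ k) sums Re (zeta (of_nat k))"
    using sums_Re[OF zeta_of_nat_sums[OF assms]] by simp
  hence "(\<lambda>n. 1 / real (Suc (Suc n)) ^ k) sums (Re (zeta (of_nat k)) - 1 / real (Suc 0) ^ k)"
    by (subst sums_Suc_iff) simp
  thus ?thesis by (simp add: add_ac)
qed

text \<open>
  Tonelli's theorem for double series: nonnegative terms make the family unconditionally summable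
  as soon as the row sums can be summed, so no estimate is needed to exchange the two summations.
\<close>

lemma sums_swap_nonneg:
  fixes f :: "nat \<Rightarrow> nat \<Rightarrow> real"
  assumes nonneg: "\<And>n j. f n j \<ge> 0"
    and rows: "\<And>n. (\<lambda>j. f n j) sums r n"
    and columns: "\<And>j. (\<lambda>n. f n j) sums c j"
    and total: "r sums S"
  shows "c sums S"
proof -
  have r: "((\<lambda>j. f n j) has_sum r n) UNIV" for n
    using rows nonneg by (intro sums_nonneg_imp_has_sum)
  have r_nonneg: "r n \<ge> 0" for n
    using sums_le[OF _ sums_zero rows[of n]] nonneg by simp
  have S: "(r has_sum S) UNIV"
    using total r_nonneg by (intro sums_nonneg_imp_has_sum)
  have "(\<lambda>(n, j). f n j) summable_on UNIV \<times> UNIV"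
    using r S nonneg by (intro summable_on_SigmaI[where g = r]) (auto simp: summable_on_def)
  hence "((\<lambda>(n, j). f n j) has_sum S) (UNIV \<times> UNIV)"
    using r S by (intro has_sum_SigmaI[where g = r]) auto
  hence "((\<lambda>(j, n). f n j) has_sum S) (UNIV \<times> UNIV)"
    by (subst (asm) has_sum_swap) simp
  moreover have "((\<lambda>n. case (j, n) of (j, n) \<Rightarrow> f n j) has_sum c j) UNIV" for j
    using columns nonneg by (simp add: sums_nonneg_imp_has_sum)
  ultimately have "(c has_sum S) UNIV"
    by (rule has_sum_SigmaD)
  thus ?thesis by (rule has_sum_imp_sums)
qed

lemma minus_ln_one_minus_sums:
  fixes y :: real
  assumes "\<bar>y\<bar> < 1"
  shows "(\<lambda>j. y ^ Suc j / real (Suc j)) sums (- ln (1 - y))"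
proof -
  have "(\<lambda>n. - (y ^ n) / real n) sums ln (1 - y)"
    using ln_series'[of "- y"] assms by simp
  hence "(\<lambda>n. y ^ n / real n) sums (- ln (1 - y))"
    using sums_minus by fastforce
  thus ?thesis by (subst sums_Suc_iff) simp
qed

text \<open>
  Euler's sine product without its factors at \<open>0\<close> and \<open>1\<close>. For \<open>\<bar>x\<bar> < 2\<close> all remaining
  factors \<open>1 - x\<^sup>2/n\<^sup>2\<close> are positive, so the logarithm of the partial products may be taken term
  by term; the excluded points are those at which the limit is of the form \<open>0/0\<close>.
\<close>

lemma minus_ln_sine_factors_sums:
  fixes x :: real
  assumes "\<bar>x\<bar> < 2" "x \<noteq> 0" "\<bar>x\<bar> \<noteq> 1"
  shows "(\<lambda>n. - ln (1 - x\<^sup>2 / real (n + 2) ^ 2)) sums ln (pi * x * (1 - x\<^sup>2) / sin (pi * x))"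
proof -
  define a where "a n = 1 - x\<^sup>2 / real (n + 2) ^ 2" for n
  define P where "P = sin (pi * x) / (pi * x * (1 - x\<^sup>2))"
  have a_pos: "a n > 0" for n
  proof -
    have "\<bar>x\<bar> < real (n + 2)" using assms by simp
    hence "x\<^sup>2 < real (n + 2) ^ 2"
      by (metis abs_ge_zero power2_abs power_strict_mono zero_less_numeral)
    moreover have "real (n + 2) ^ 2 > 0" by (simp del: of_nat_add)
    ultimately show ?thesis by (simp add: a_def del: of_nat_add)
  qed
  have x2: "1 - x\<^sup>2 \<noteq> 0" using assms by (auto simp: power2_eq_1_iff)
  have "sin (pi * x) \<noteq> 0"
  proof
    assume "sin (pi * x) = 0"
    then obtain i :: int where "pi * x = of_int i * pi" by (auto simp: sin_zero_iff_int2)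
    hence i: "x = of_int i" by simp
    hence "\<bar>i\<bar> < 2" "i \<noteq> 0" "\<bar>i\<bar> \<noteq> 1" using assms by linarith+
    thus False by linarith
  qed
  hence "P \<noteq> 0" using x2 assms by (simp add: P_def)
  have "(\<lambda>n. \<Prod>k=1..n. 1 - x\<^sup>2 / real k ^ 2) \<longlonglongrightarrow> sin (pi * x) / (pi * x)"
    using assms by (intro sin_product_formula_real')
  hence "(\<lambda>n. \<Prod>k=1..Suc n. 1 - x\<^sup>2 / real k ^ 2) \<longlonglongrightarrow> sin (pi * x) / (pi * x)"
    by (rule LIMSEQ_Suc)
  moreover have "(\<Prod>k=1..Suc n. 1 - x\<^sup>2 / real k ^ 2) = (1 - x\<^sup>2) * (\<Prod>k<n. a k)" for n
    by (induction n) (simp_all add: a_def mult_ac)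
  ultimately have "(\<lambda>n. (1 - x\<^sup>2) * (\<Prod>k<n. a k)) \<longlonglongrightarrow> sin (pi * x) / (pi * x)"
    by simp
  hence "(\<lambda>n. (1 - x\<^sup>2) * (\<Prod>k<n. a k) / (1 - x\<^sup>2)) \<longlonglongrightarrow> sin (pi * x) / (pi * x) / (1 - x\<^sup>2)"
    by (intro tendsto_divide tendsto_const x2)
  hence lim: "(\<lambda>n. \<Prod>k<n. a k) \<longlonglongrightarrow> P"
    using x2 by (simp add: P_def)
  hence "P \<ge> 0"
    by (rule LIMSEQ_le_const) (meson a_pos less_imp_le prod_nonneg)
  hence "P > 0" using \<open>P \<noteq> 0\<close> by simp
  have "(\<lambda>n. - ln (\<Prod>k<n. a k)) \<longlonglongrightarrow> - ln P"
    using lim \<open>P \<noteq> 0\<close> by (intro tendsto_intros)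
  moreover have "- ln (\<Prod>k<n. a k) = (\<Sum>k<n. - ln (a k))" for n
    using a_pos by (subst ln_prod) (simp_all add: sum_negf less_imp_neq[THEN not_sym])
  moreover have "- ln P = ln (inverse P)"
    using \<open>P > 0\<close> by (simp add: ln_inverse)
  moreover have "inverse P = pi * x * (1 - x\<^sup>2) / sin (pi * x)"
    by (simp add: P_def)
  ultimately show ?thesis by (simp add: sums_def a_def)
qed

text \<open>
  The double family \<open>(x\<^sup>2/n\<^sup>2)\<^bsup>k\<^esup>/k\<close>, with \<open>n \<ge> 2\<close> and \<open>k \<ge> 1\<close>, is nonnegative. Its sums over \<open>n\<close>
  are the terms of the zeta series, and its sums over \<open>k\<close> are the logarithms of the sine factors.
\<close>

lemma zeta_even_log_series:
  fixes x :: real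
  assumes "\<bar>x\<bar> < 2" "x \<noteq> 0" "\<bar>x\<bar> \<noteq> 1"
  shows "(\<lambda>j. (Re (zeta (of_nat (2 * Suc j))) - 1) * (x ^ (2 * Suc j) / real (Suc j)))
           sums ln (pi * x * (1 - x\<^sup>2) / sin (pi * x))"
proof -
  define f where "f n j = (x\<^sup>2 / real (n + 2) ^ 2) ^ Suc j / real (Suc j)" for n j
  have f_alt: "f n j = 1 / real (n + 2) ^ (2 * Suc j) * (x ^ (2 * Suc j) / real (Suc j))" for n j
    unfolding f_def by (simp only: power_divide power_mult[symmetric]) simp
  show ?thesis
  proof (rule sums_swap_nonneg)
    show "f n j \<ge> 0" for n j
      by (simp add: f_def del: of_nat_add of_nat_Suc)
    show "f n sums (- ln (1 - x\<^sup>2 / real (n + 2) ^ 2))" for n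
      unfolding f_def
    proof (rule minus_ln_one_minus_sums)
      have "\<bar>x\<bar> < real (n + 2)" using assms by simp
      hence "x\<^sup>2 < real (n + 2) ^ 2"
        by (metis abs_ge_zero power2_abs power_strict_mono zero_less_numeral)
      thus "\<bar>x\<^sup>2 / real (n + 2) ^ 2\<bar> < 1" by (simp del: of_nat_add)
    qed
    show "(\<lambda>n. f n j) sums
            ((Re (zeta (of_nat (2 * Suc j))) - 1) * (x ^ (2 * Suc j) / real (Suc j)))" for j
      unfolding f_alt by (intro sums_mult2 zeta_of_nat_minus_one_sums) simp
    show "(\<lambda>n. - ln (1 - x\<^sup>2 / real (n + 2) ^ 2)) sums ln (pi * x * (1 - x\<^sup>2) / sin (pi * x))"
      using assms by (rule minus_ln_sine_factors_sums)
  qed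
qed

section \<open>Binet's formulas for integer indices\<close>

definition golden_conjugate :: real where
  "golden_conjugate = (1 - sqrt 5) / 2"

lemma golden_ratio_mult_conjugate: "golden_ratio * golden_conjugate = -1"
  by (simp add: golden_ratio_def golden_conjugate_def field_simps)

lemma golden_ratio_square: "golden_ratio\<^sup>2 = golden_ratio + 1"
  by (simp add: golden_ratio_def power2_eq_square field_simps)

lemma golden_conjugate_square: "golden_conjugate\<^sup>2 = golden_conjugate + 1"
  by (simp add: golden_conjugate_def power2_eq_square field_simps)

lemma golden_ratio_bounds: "1 < golden_ratio" "golden_ratio < 2"
proof -
  have "sqrt 5 < 3" by (rule real_less_lsqrt) auto
  moreover have "1 < sqrt 5" by simp
  ultimately show "1 < golden_ratio" "golden_ratio < 2" by (simp_all add: golden_ratio_def)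
qed

lemma golden_conjugate_eq: "golden_conjugate = - inverse golden_ratio"
  using golden_ratio_mult_conjugate golden_ratio_bounds by (simp add: field_simps)

lemma lucas_closed_form: "real (lucas n) = golden_ratio ^ n + golden_conjugate ^ n"
proof (induction n rule: lucas.induct)
  case (3 n)
  have "golden_ratio ^ Suc (Suc n) + golden_conjugate ^ Suc (Suc n) =
          golden_ratio ^ n * golden_ratio\<^sup>2 + golden_conjugate ^ n * golden_conjugate\<^sup>2"
    by (simp add: power2_eq_square)
  thus ?case
    using 3 by (simp add: golden_ratio_square golden_conjugate_square algebra_simps)
qed (simp_all add: golden_ratio_def golden_conjugate_def field_simps)

text \<open>
  The sign rules for negative indices are exactly what Binet's formulas dictate, because
  \<open>\<alpha>\<^bsup>-n\<^esup> = (-1)\<^bsup>n\<^esup> \<beta>\<^bsup>n\<^esup>\<close> and \<open>\<beta>\<^bsup>-n\<^esup> = (-1)\<^bsup>n\<^esup> \<alpha>\<^bsup>n\<^esup>\<close>.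
\<close>

lemma golden_powi_neg:
  assumes "i < 0"
  shows "golden_ratio powi i = (-1) ^ nat (- i) * golden_conjugate ^ nat (- i)"
    and "golden_conjugate powi i = (-1) ^ nat (- i) * golden_ratio ^ nat (- i)"
  using assms
  by (simp_all add: power_int_def golden_conjugate_eq flip: power_mult_distrib)

lemma fib_int_binet:
  "real_of_int (fib_int i) = (golden_ratio powi i - golden_conjugate powi i) / sqrt 5"
proof (cases "i \<ge> 0")
  case True
  thus ?thesis
    by (simp add: fib_int_def power_int_def fib_closed_form golden_ratio_def golden_conjugate_def)
next
  case False
  hence "real_of_int (fib_int i) = - ((-1) ^ nat (- i)) * real (fib (nat (- i)))"
    by (simp add: fib_int_def)
  also have "real (fib (nat (- i))) =
      (golden_ratio ^ nat (- i) - golden_conjugate ^ nat (- i)) / sqrt 5"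
    by (simp add: fib_closed_form golden_ratio_def golden_conjugate_def)
  finally show ?thesis
    using False by (simp add: golden_powi_neg field_simps)
qed

lemma lucas_int_binet:
  "real_of_int (lucas_int i) = golden_ratio powi i + golden_conjugate powi i"
proof (cases "i \<ge> 0")
  case True
  thus ?thesis by (simp add: lucas_int_def power_int_def lucas_closed_form)
next
  case False
  thus ?thesis
    by (simp add: lucas_int_def lucas_closed_form golden_powi_neg algebra_simps)
qed

section \<open>The two golden evaluations\<close>

text \<open>
  Positivity allows the logarithm of a product with this factor to be split. It holds since
  \<open>\<surd>5\<pi>/2\<close> lies between \<open>\<pi>\<close> and \<open>3\<pi>/2\<close>, where the cosine is negative.
\<close>

lemma minus_pi_sec_pos: "- pi * sec (sqrt 5 * pi / 2) > 0"
proof -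
  have "sqrt 5 < 3" by (rule real_less_lsqrt) auto
  moreover have "2 < sqrt 5" by (rule real_less_rsqrt) auto
  ultimately have "cos (sqrt 5 * pi / 2 - pi) > 0"
    by (intro cos_gt_zero_pi) (auto simp: field_simps)
  hence "cos (sqrt 5 * pi / 2) < 0" by (simp add: cos_diff)
  thus ?thesis by (simp add: sec_def field_simps)
qed

lemma zeta_even_log_series_golden_ratio:
  "(\<lambda>j. (Re (zeta (of_nat (2 * Suc j))) - 1) * (golden_ratio ^ (2 * Suc j) / real (Suc j)))
     sums (ln (- pi * sec (sqrt 5 * pi / 2)) + 2 * ln golden_ratio)"
proof -
  have one_minus: "1 - golden_ratio\<^sup>2 = - golden_ratio"
    by (simp add: golden_ratio_square)
  have "pi * golden_ratio = sqrt 5 * pi / 2 + pi / 2"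
    by (simp add: golden_ratio_def field_simps)
  hence "sin (pi * golden_ratio) = cos (sqrt 5 * pi / 2)"
    by (simp add: sin_add)
  hence "pi * golden_ratio * (1 - golden_ratio\<^sup>2) / sin (pi * golden_ratio) =
          (- pi * sec (sqrt 5 * pi / 2)) * golden_ratio\<^sup>2"
    unfolding one_minus by (simp add: sec_def power2_eq_square)
  also have "ln \<dots> = ln (- pi * sec (sqrt 5 * pi / 2)) + 2 * ln golden_ratio"
    using minus_pi_sec_pos golden_ratio_bounds by (subst ln_mult_pos) (auto simp: ln_realpow)
  finally show ?thesis
    using zeta_even_log_series[of golden_ratio] golden_ratio_bounds by simp
qed

lemma zeta_even_log_series_golden_conjugate:
  "(\<lambda>j. (Re (zeta (of_nat (2 * Suc j))) - 1) * (golden_conjugate ^ (2 * Suc j) / real (Suc j)))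
     sums (ln (- pi * sec (sqrt 5 * pi / 2)) - 2 * ln golden_ratio)"
proof -
  have abs_conj: "\<bar>golden_conjugate\<bar> < 1" "golden_conjugate \<noteq> 0"
    using golden_ratio_bounds by (auto simp: golden_conjugate_eq field_simps)
  have one_minus: "1 - golden_conjugate\<^sup>2 = - golden_conjugate"
    by (simp add: golden_conjugate_square)
  have "pi * golden_conjugate = pi / 2 - sqrt 5 * pi / 2"
    by (simp add: golden_conjugate_def field_simps)
  hence "sin (pi * golden_conjugate) = cos (sqrt 5 * pi / 2)"
    by (simp add: sin_diff)
  hence "pi * golden_conjugate * (1 - golden_conjugate\<^sup>2) / sin (pi * golden_conjugate) =
          (- pi * sec (sqrt 5 * pi / 2)) * golden_conjugate\<^sup>2"
    unfolding one_minus by (simp add: sec_def power2_eq_square)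
  also have "\<dots> = - pi * sec (sqrt 5 * pi / 2) * inverse (golden_ratio\<^sup>2)"
    by (simp add: golden_conjugate_eq power_inverse)
  also have "ln (- pi * sec (sqrt 5 * pi / 2) * inverse (golden_ratio\<^sup>2)) =
               ln (- pi * sec (sqrt 5 * pi / 2)) - 2 * ln golden_ratio"
    using minus_pi_sec_pos golden_ratio_bounds
    by (subst ln_mult_pos) (auto simp: ln_realpow ln_inverse)
  finally show ?thesis
    using zeta_even_log_series[of golden_conjugate] abs_conj by simp
qed

section \<open>The Fibonacci and Lucas series\<close>

text \<open>
  The Fibonacci numbers are the case \<open>u = 1/\<surd>5\<close>, \<open>v = -1/\<surd>5\<close> and the Lucas numbers the case
  \<open>u = v = 1\<close>. The second term carries \<open>-v\<close> because \<open>ln \<bar>\<beta>\<bar> = -ln \<alpha>\<close>.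
\<close>

lemma zeta_even_binet_series:
  fixes u v :: real and m :: int and h :: "int \<Rightarrow> int"
  assumes h: "\<And>i. real_of_int (h i) = u * golden_ratio powi i + v * golden_conjugate powi i"
  shows "(\<lambda>j. let k = Suc j in
            (zeta (of_nat (2 * k)) - 1) * (of_int (h (2 * int k + m - 1)) / of_nat k))
          sums complex_of_real
            (of_int (h (m - 1)) * ln (- pi * sec (sqrt 5 * pi / 2))
             + 2 * (u * golden_ratio powi (m - 1) - v * golden_conjugate powi (m - 1))
                 * ln golden_ratio)"
proof -
  define a b where "a = u * golden_ratio powi (m - 1)" and "b = v * golden_conjugate powi (m - 1)"
  define A where "A = ln (- pi * sec (sqrt 5 * pi / 2))"
  define z where "z j = Re (zeta (of_nat (2 * Suc j))) - 1" for j
  have shift: "x powi (2 * int (Suc j) + m - 1) = x ^ (2 * Suc j) * x powi (m - 1)"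
    if "x \<noteq> 0" for x :: real and j
  proof -
    have "x powi (2 * int (Suc j) + m - 1) = x powi (int (2 * Suc j) + (m - 1))"
      by (simp add: algebra_simps)
    also have "\<dots> = x ^ (2 * Suc j) * x powi (m - 1)"
      using that by (subst power_int_add) (simp_all only: power_int_of_nat, simp)
    finally show ?thesis .
  qed
  have nz: "golden_ratio \<noteq> 0" "golden_conjugate \<noteq> 0"
    using golden_ratio_mult_conjugate by auto
  have "(\<lambda>j. a * (z j * (golden_ratio ^ (2 * Suc j) / real (Suc j))) +
             b * (z j * (golden_conjugate ^ (2 * Suc j) / real (Suc j))))
          sums (a * (A + 2 * ln golden_ratio) + b * (A - 2 * ln golden_ratio))"
    unfolding z_def A_def
    by (intro sums_add sums_mult zeta_even_log_series_golden_ratio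
          zeta_even_log_series_golden_conjugate)
  also have "(\<lambda>j. a * (z j * (golden_ratio ^ (2 * Suc j) / real (Suc j))) +
                  b * (z j * (golden_conjugate ^ (2 * Suc j) / real (Suc j)))) =
             (\<lambda>j. z j * (of_int (h (2 * int (Suc j) + m - 1)) / real (Suc j)))"
    unfolding h shift[OF nz(1)] shift[OF nz(2)] a_def b_def
    by (rule ext) (simp add: field_simps del: of_nat_Suc power_Suc mult_Suc_right)
  also have "a * (A + 2 * ln golden_ratio) + b * (A - 2 * ln golden_ratio) =
             of_int (h (m - 1)) * A + 2 * (a - b) * ln golden_ratio"
    unfolding h a_def b_def by (simp add: algebra_simps)
  finally have "(\<lambda>j. complex_of_real (z j * (of_int (h (2 * int (Suc j) + m - 1)) / real (Suc j))))
                  sums complex_of_real (of_int (h (m - 1)) * A + 2 * (a - b) * ln golden_ratio)"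
    by (subst sums_of_real_iff)
  moreover have "complex_of_real (z j) = zeta (of_nat (2 * Suc j)) - 1" for j
    using of_real_Re_zeta_of_nat[of "2 * Suc j"] by (simp add: z_def del: mult_Suc_right)
  ultimately show ?thesis
    unfolding A_def a_def b_def Let_def of_real_mult of_real_divide of_real_of_int_eq of_real_of_nat_eq
    by simp
qed

theorem theorem3p1:
  fixes m :: int
  assumes "m \<ge> 0"
  shows "(\<lambda>j. let k = Suc j in
            (zeta (of_nat (2 * k)) - 1) * (of_int (fib_int (2 * int k + m - 1)) / of_nat k))
          sums complex_of_real
            (of_int (fib_int (m - 1)) * ln (- pi * sec (sqrt 5 * pi / 2))
             + 2 / sqrt 5 * of_int (lucas_int (m - 1)) * ln golden_ratio)
       \<and> (\<lambda>j. let k = Suc j in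
            (zeta (of_nat (2 * k)) - 1) * (of_int (lucas_int (2 * int k + m - 1)) / of_nat k))
          sums complex_of_real
            (of_int (lucas_int (m - 1)) * ln (- pi * sec (sqrt 5 * pi / 2))
             + 2 * sqrt 5 * of_int (fib_int (m - 1)) * ln golden_ratio)"
proof
  have fib: "real_of_int (fib_int i) =
      1 / sqrt 5 * golden_ratio powi i + (- 1 / sqrt 5) * golden_conjugate powi i" for i
    by (simp add: fib_int_binet diff_divide_distrib)
  have "2 * (1 / sqrt 5 * golden_ratio powi (m - 1)
             - (- 1 / sqrt 5) * golden_conjugate powi (m - 1)) =
        2 / sqrt 5 * of_int (lucas_int (m - 1))"
    by (simp add: lucas_int_binet add_divide_distrib)
  from zeta_even_binet_series[OF fib, of m, unfolded this]
  show "(\<lambda>j. let k = Suc j in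
            (zeta (of_nat (2 * k)) - 1) * (of_int (fib_int (2 * int k + m - 1)) / of_nat k))
          sums complex_of_real
            (of_int (fib_int (m - 1)) * ln (- pi * sec (sqrt 5 * pi / 2))
             + 2 / sqrt 5 * of_int (lucas_int (m - 1)) * ln golden_ratio)" .
next
  have lucas: "real_of_int (lucas_int i) =
      1 * golden_ratio powi i + 1 * golden_conjugate powi i" for i
    by (simp add: lucas_int_binet)
  have "2 * (1 * golden_ratio powi (m - 1) - 1 * golden_conjugate powi (m - 1)) =
        2 * sqrt 5 * of_int (fib_int (m - 1))"
    by (simp add: fib_int_binet)
  from zeta_even_binet_series[OF lucas, of m, unfolded this]
  show "(\<lambda>j. let k = Suc j in
            (zeta (of_nat (2 * k)) - 1) * (of_int (lucas_int (2 * int k + m - 1)) / of_nat k))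
          sums complex_of_real
            (of_int (lucas_int (m - 1)) * ln (- pi * sec (sqrt 5 * pi / 2))
             + 2 * sqrt 5 * of_int (fib_int (m - 1)) * ln golden_ratio)" .
qed

end
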